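(* Let $d\geq 2$ be an integer. For any sequence $(a_n)_{n\ge1}$ in $\mathbb{R}^d$ with $\|a_n\|\to 0$ we have $$\dim\left\{\varepsilon=(\varepsilon_n)_{n\ge1} \in \Omega:\ \sum_{n=1}^\infty \varepsilon_n a_n \text{ is convergent} \right\}=1.$$
   Context: $\Omega=\{-1,1\}^{\mathbb{N}}$ (with $\mathbb{N}=\{1,2,\dots\}$) is the set of infinite sign sequences, equipped with the ultrametric $\rho(\varepsilon,\omega)=2^{-\min\{n:\ \varepsilon_n\neq\omega_n\}}$ for $\varepsilon\ne\omega$, and $\rho(\varepsilon,\varepsilon)=0$. $\dim$ denotes Hausdorff dimension of subsets of $(\Omega,\rho)$. $\|\cdot\|$ is the Euclidean norm on $\mathbb{R}^d$. Convergence of a series means convergence of its sequence of partial sums. *)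

theory Defs
  imports "HOL-Analysis.Analysis"
begin

section \<open>Hausdorff measure and Hausdorff dimension\<close>

text \<open>
  The weight \<open>(diam U)\<^sup>s\<close> with the usual conventions at \<open>s = 0\<close>: the empty set has weight 0
  and every nonempty set has weight 1. (The case distinction is needed because
  \<^term>\<open>0 powr (0::real) = 0\<close>.)
\<close>

definition hausdorff_weight :: "real \<Rightarrow> 'a::metric_space set \<Rightarrow> real" where
  "hausdorff_weight s U =
     (if U = {} then 0 else if s = 0 then 1 else diameter U powr s)"

text \<open>
  Covers by at most countably many sets are sequences of sets, padded with the empty set.
  Boundedness is required explicitly, since \<^const>\<open>diameter\<close> is real-valued and carries no
  information for unbounded sets.
\<close>

definition hausdorff_cover :: "real \<Rightarrow> 'a::metric_space set \<Rightarrow> (nat \<Rightarrow> 'a set) \<Rightarrow> bool" where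
  "hausdorff_cover \<delta> A U \<longleftrightarrow>
     A \<subseteq> (\<Union>i. U i) \<and> (\<forall>i. bounded (U i) \<and> diameter (U i) \<le> \<delta>)"

definition hausdorff_premeasure :: "real \<Rightarrow> real \<Rightarrow> 'a::metric_space set \<Rightarrow> ennreal" where
  "hausdorff_premeasure s \<delta> A =
     (INF U\<in>{U. hausdorff_cover \<delta> A U}. \<Sum>i. ennreal (hausdorff_weight s (U i)))"

definition hausdorff_measure :: "real \<Rightarrow> 'a::metric_space set \<Rightarrow> ennreal" where
  "hausdorff_measure s A = (SUP \<delta>\<in>{0<..}. hausdorff_premeasure s \<delta> A)"

text \<open>The infimum is taken in \<^typ>\<open>ennreal\<close>, so it is \<open>\<infinity>\<close> if no such \<open>s\<close> exists.\<close>

definition hausdorff_dim :: "'a::metric_space set \<Rightarrow> ennreal" where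
  "hausdorff_dim A = (INF s\<in>{s. 0 \<le> s \<and> hausdorff_measure s A = 0}. ennreal s)"


section \<open>The space of sign sequences\<close>

text \<open>
  Sequences are indexed by the positive integers; extensionality fixes the irrelevant
  value at index 0.
\<close>

typedef sign_seq = "{1::nat..} \<rightarrow>\<^sub>E {-1, 1::real}"
  morphisms sgn_at Abs_sign_seq
  by (rule exI[of _ "restrict (\<lambda>_. 1) {1..}"]) auto

lemma sign_seq_eq_iff: "x = y \<longleftrightarrow> (\<forall>n\<ge>1. sgn_at x n = sgn_at y n)"
proof
  assume "\<forall>n\<ge>1. sgn_at x n = sgn_at y n"
  then have "sgn_at x = sgn_at y"
    using sgn_at[of x] sgn_at[of y] by (intro PiE_ext) auto
  then show "x = y" by (simp add: sgn_at_inject)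
qed simp

instantiation sign_seq :: metric_space
begin

definition dist_sign_seq :: "sign_seq \<Rightarrow> sign_seq \<Rightarrow> real" where
  "dist x y = (if x = y then 0 else (1/2) ^ (LEAST n. 1 \<le> n \<and> sgn_at x n \<noteq> sgn_at y n))"

definition uniformity_sign_seq_def:
  "(uniformity :: (sign_seq \<times> sign_seq) filter) = (INF e\<in>{0<..}. principal {(x, y). dist x y < e})"

definition open_sign_seq_def:
  "open (U :: sign_seq set) \<longleftrightarrow> (\<forall>x\<in>U. \<forall>\<^sub>F (x', y) in uniformity. x' = x \<longrightarrow> y \<in> U)"

instance
proof
  fix x y z :: sign_seq
  show "dist x y = 0 \<longleftrightarrow> x = y"
    by (simp add: dist_sign_seq_def)
  show "dist x y \<le> dist x z + dist y z"
  proof (cases "x = y \<or> x = z \<or> y = z")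
    case True
    moreover have "dist x x = 0" for x :: sign_seq
      by (simp add: dist_sign_seq_def)
    moreover have "0 \<le> dist x y" for x y :: sign_seq
      by (simp add: dist_sign_seq_def)
    moreover have "dist x y = dist y x" for x y :: sign_seq
    proof -
      have "(\<lambda>n. 1 \<le> n \<and> sgn_at x n \<noteq> sgn_at y n) = (\<lambda>n. 1 \<le> n \<and> sgn_at y n \<noteq> sgn_at x n)"
        by (rule ext) metis
      then show ?thesis
        unfolding dist_sign_seq_def by auto
    qed
    ultimately show ?thesis by (elim disjE) simp_all
  next
    case False
    define L :: "sign_seq \<Rightarrow> sign_seq \<Rightarrow> nat"
      where "L = (\<lambda>u v. LEAST n. 1 \<le> n \<and> sgn_at u n \<noteq> sgn_at v n)"
    have "\<exists>n. 1 \<le> n \<and> sgn_at x n \<noteq> sgn_at y n"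
      using False by (auto simp: sign_seq_eq_iff)
    from LeastI_ex[OF this]
    have xy: "1 \<le> L x y" "sgn_at x (L x y) \<noteq> sgn_at y (L x y)"
      unfolding L_def by blast+
    then consider "sgn_at x (L x y) \<noteq> sgn_at z (L x y)" | "sgn_at y (L x y) \<noteq> sgn_at z (L x y)"
      by fastforce
    then have "L x z \<le> L x y \<or> L y z \<le> L x y"
    proof cases
      case 1
      then have "L x z \<le> L x y"
        unfolding L_def[THEN fun_cong, THEN fun_cong, of x z] by (intro Least_le conjI xy(1))
      then show ?thesis ..
    next
      case 2
      then have "L y z \<le> L x y"
        unfolding L_def[THEN fun_cong, THEN fun_cong, of y z] by (intro Least_le conjI xy(1))
      then show ?thesis ..
    qed
    then have "(1/2::real) ^ L x y \<le> (1/2) ^ L x z \<or> (1/2::real) ^ L x y \<le> (1/2) ^ L y z"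
      by (auto intro: power_decreasing)
    moreover have "0 \<le> (1/2::real) ^ L x z" "0 \<le> (1/2::real) ^ L y z"
      by simp_all
    ultimately have "(1/2::real) ^ L x y \<le> (1/2) ^ L x z + (1/2) ^ L y z"
      by linarith
    then show ?thesis
      using False by (simp add: dist_sign_seq_def L_def)
  qed
qed (rule uniformity_sign_seq_def open_sign_seq_def)+

end

end

theory Submission
  imports Defs "HOL-Probability.Probability"
begin

text \<open>
  Cut the positive integers into blocks of length \<open>m\<close>. Given any sign sequence \<open>h\<close>, the block sums of
  \<open>h n *\<^sub>R a n\<close> tend to 0, so by the Dvoretzky--Hanani theorem there is one sign per block such that,
  after multiplying \<open>h\<close> by these signs, the series converges. Thus every sign sequence becomes an
  element of the set in question after changing one sign per block. As a cylinder of length \<open>n\<close> meets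
  about \<open>n / m\<close> blocks, its preimage under this correction has coin tossing measure at most
  \<open>2 * (1/2) ^ n * 2 ^ (n div m)\<close>. The mass distribution principle then gives
  dimension at least \<open>1 - 1/m\<close>, for every \<open>m\<close>.
\<close>

section \<open>Signed series\<close>

text \<open>Stated for families because terms of a series may repeat, whereas
  \<open>dependent\<close> speaks of sets. A repetition \<open>v i = v j\<close> gives the relation
  with coefficients 1 and -1; otherwise the relation is carried back from the image.\<close>

lemma linear_dependence_indexed:
  fixes v :: "'i \<Rightarrow> 'a::euclidean_space"
  assumes "finite F" and "card F > DIM('a)"
  obtains c where "(\<Sum>i\<in>F. c i *\<^sub>R v i) = 0" and "\<exists>i\<in>F. c i \<noteq> 0"
proof (cases "inj_on v F")
  case True
  then have "card (v ` F) > DIM('a)"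
    using assms by (simp add: card_image)
  then have "dependent (v ` F)"
    using independent_bound[of "v ` F"] by auto
  then obtain u where u: "(\<Sum>x\<in>v ` F. u x *\<^sub>R x) = 0" "\<exists>x\<in>v ` F. u x \<noteq> 0"
    using assms(1) by (auto simp: dependent_finite)
  show ?thesis
    by (rule that[of "u \<circ> v"]) (use u True in \<open>auto simp: sum.reindex\<close>)
next
  case False
  then obtain i j where ij: "i \<in> F" "j \<in> F" "i \<noteq> j" "v i = v j"
    by (auto simp: inj_on_def)
  define c where "c = (\<lambda>k. if k = i then 1 else if k = j then -1 else (0::real))"
  have "(\<Sum>k\<in>F. c k *\<^sub>R v k) = (\<Sum>k\<in>{i, j}. c k *\<^sub>R v k)"
    by (rule sum.mono_neutral_right) (use ij assms(1) in \<open>auto simp: c_def\<close>)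
  also have "\<dots> = 0"
    using ij by (simp add: c_def)
  finally have "(\<Sum>k\<in>F. c k *\<^sub>R v k) = 0" .
  then show ?thesis
    by (rule that) (use ij(1) in \<open>auto simp: c_def\<close>)
qed

text \<open>The point \<open>l\<close> lies in the open cube, so a ray from it in the nonzero
  direction \<open>c\<close> stays in the closed cube until it first meets a face.\<close>

lemma move_to_face_of_cube:
  fixes l c :: "'i \<Rightarrow> real"
  assumes "finite F" and l: "\<And>i. i \<in> F \<Longrightarrow> \<bar>l i\<bar> < 1" and c: "\<exists>i\<in>F. c i \<noteq> 0"
  obtains t where "\<And>i. i \<in> F \<Longrightarrow> \<bar>l i + t * c i\<bar> \<le> 1" and "\<exists>i\<in>F. \<bar>l i + t * c i\<bar> = 1"
proof -
  define G where "G = {i \<in> F. c i \<noteq> 0}"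
  \<comment> \<open>For \<open>c i\<close> nonzero, \<open>T i\<close> is the time at which
    coordinate \<open>i\<close> of the ray reaches \<open>sgn (c i)\<close>, the face it moves
    towards; the minimum over \<open>G\<close> is the exit time.\<close>
  define T where "T = (\<lambda>i. (1 - sgn (c i) * l i) / \<bar>c i\<bar>)"
  define t where "t = Min (T ` G)"
  have G: "finite (T ` G)" "T ` G \<noteq> {}"
    using assms(1) c by (auto simp: G_def)
  have Tpos: "T i > 0" if "i \<in> G" for i
  proof -
    have "i \<in> F" "c i \<noteq> 0" using that by (auto simp: G_def)
    then show ?thesis
      using l[of i] by (cases "c i > 0") (auto simp: T_def sgn_if intro!: divide_pos_neg)
  qed
  have "t \<in> T ` G"
    unfolding t_def using G by (rule Min_in)
  then obtain k where k: "k \<in> G" "t = T k"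
    by auto
  have tpos: "t > 0" using Tpos k by simp
  have tle: "t \<le> T i" if "i \<in> G" for i
    unfolding t_def using G that by simp
  have le: "\<bar>l i + t * c i\<bar> \<le> 1" if "i \<in> F" for i
  proof (cases "c i = 0")
    case True
    then show ?thesis using l[OF that] by simp
  next
    case False
    then have "t * \<bar>c i\<bar> \<le> 1 - sgn (c i) * l i"
      using tle[of i] that by (simp add: G_def T_def pos_le_divide_eq)
    moreover have "t * \<bar>c i\<bar> > 0"
      using tpos False by simp
    ultimately show ?thesis
      using l[OF that] False by (auto simp: sgn_if abs_if split: if_splits)
  qed
  have "\<bar>l k + t * c k\<bar> = 1"
    using k tpos by (cases "c k > 0") (auto simp: G_def T_def sgn_if abs_if field_simps)
  with k have "\<exists>i\<in>F. \<bar>l i + t * c i\<bar> = 1"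
    by (auto simp: G_def)
  with le show ?thesis by (rule that)
qed

definition fractional_signing :: "(nat \<Rightarrow> 'a::euclidean_space) \<Rightarrow> nat \<Rightarrow> (nat \<Rightarrow> real) \<Rightarrow> bool" where
  "fractional_signing v n l \<longleftrightarrow>
     (\<forall>i. \<bar>l i\<bar> \<le> 1) \<and> (\<forall>i\<ge>n. l i = 0) \<and> (\<Sum>i<n. l i *\<^sub>R v i) = 0 \<and>
     card {i. i < n \<and> \<bar>l i\<bar> < 1} \<le> DIM('a)"

text \<open>Admitting index \<open>n\<close> may leave \<open>DIM('a) + 1\<close> coordinates
  unfrozen. Their vectors are then linearly dependent, and moving along a relation keeps the sum
  zero until one more coordinate freezes. Frozen coordinates lie outside \<open>F\<close> and do not
  move.\<close>

lemma fractional_signing_extend: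
  fixes v :: "nat \<Rightarrow> 'a::euclidean_space"
  assumes "fractional_signing v n l"
  shows "\<exists>l'. fractional_signing v (Suc n) l' \<and> (\<forall>i. \<bar>l i\<bar> = 1 \<longrightarrow> l' i = l i)"
proof -
  define F where "F = {i. i < Suc n \<and> \<bar>l i\<bar> < 1}"
  have l: "\<And>i. \<bar>l i\<bar> \<le> 1" "\<And>i. i \<ge> n \<Longrightarrow> l i = 0" "(\<Sum>i<n. l i *\<^sub>R v i) = 0"
    "card {i. i < n \<and> \<bar>l i\<bar> < 1} \<le> DIM('a)"
    using assms by (auto simp: fractional_signing_def)
  have F: "F = insert n {i. i < n \<and> \<bar>l i\<bar> < 1}"
    using l(2)[of n] by (auto simp: F_def)
  have finF: "finite F" by (simp add: F_def)
  have cardF: "card F \<le> Suc DIM('a)"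
    using l(4) by (simp add: F)
  show ?thesis
  proof (cases "card F \<le> DIM('a)")
    case True
    then show ?thesis
      using l by (intro exI[of _ l]) (auto simp: fractional_signing_def F_def)
  next
    case False
    then obtain c where c: "(\<Sum>i\<in>F. c i *\<^sub>R v i) = 0" "\<exists>i\<in>F. c i \<noteq> 0"
      using linear_dependence_indexed[OF finF, of v] by (metis not_le)
    then obtain t where t: "\<And>i. i \<in> F \<Longrightarrow> \<bar>l i + t * c i\<bar> \<le> 1" "\<exists>i\<in>F. \<bar>l i + t * c i\<bar> = 1"
      using move_to_face_of_cube[OF finF, of l c] by (auto simp: F_def)
    define l' where "l' = (\<lambda>i. if i \<in> F then l i + t * c i else l i)"
    have "(\<Sum>i<Suc n. l' i *\<^sub>R v i) = (\<Sum>i<Suc n. l i *\<^sub>R v i + (if i \<in> F then (t * c i) *\<^sub>R v i else 0))"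
      by (rule sum.cong) (auto simp: l'_def scaleR_left_distrib)
    also have "\<dots> = (\<Sum>i<Suc n. l i *\<^sub>R v i) + (\<Sum>i\<in>{..<Suc n} \<inter> F. (t * c i) *\<^sub>R v i)"
      by (simp add: sum.distrib sum.inter_restrict del: sum.lessThan_Suc)
    also have "{..<Suc n} \<inter> F = F"
      by (auto simp: F_def)
    also have "(\<Sum>i\<in>F. (t * c i) *\<^sub>R v i) = 0"
      using c(1) by (simp flip: scaleR_scaleR scaleR_sum_right)
    finally have sum0: "(\<Sum>i<Suc n. l' i *\<^sub>R v i) = 0"
      using l by simp
    obtain k where k: "k \<in> F" "\<bar>l k + t * c k\<bar> = 1"
      using t by blast
    have "{i. i < Suc n \<and> \<bar>l' i\<bar> < 1} \<subseteq> F - {k}"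
      using k by (auto simp: l'_def F_def)
    then have "card {i. i < Suc n \<and> \<bar>l' i\<bar> < 1} \<le> card (F - {k})"
      using finF by (intro card_mono) auto
    also have "\<dots> \<le> DIM('a)"
      using cardF k finF by simp
    finally have "fractional_signing v (Suc n) l'"
      using sum0 l t by (auto simp: fractional_signing_def l'_def F_def)
    then show ?thesis
      by (intro exI[of _ l']) (auto simp: l'_def F_def)
  qed
qed

section \<open>Sign choices with bounded and with convergent partial sums\<close>

text \<open>
  The Barany--Grinberg argument: a coordinate of the fractional signing is frozen once it reaches
  \<open>\<plusminus>1\<close>, and linear dependence keeps at most \<open>DIM('a)\<close> coordinates unfrozen at any time. Only these
  contribute to the partial sum of the limiting signs.
\<close>

lemma bounded_signed_sums:
  fixes v :: "nat \<Rightarrow> 'a::euclidean_space" and D :: real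
  assumes v: "\<And>i. norm (v i) \<le> D"
  obtains s :: "nat \<Rightarrow> real"
    where "\<And>i. s i \<in> {-1, 1}" and "\<And>n. norm (\<Sum>i<n. s i *\<^sub>R v i) \<le> 2 * DIM('a) * D"
proof -
  have D: "D \<ge> 0"
    using v[of 0] norm_ge_zero order_trans by blast
  have "\<exists>l. \<forall>n. fractional_signing v n (l n) \<and> (\<forall>i. \<bar>l n i\<bar> = 1 \<longrightarrow> l (Suc n) i = l n i)"
  proof (rule dependent_nat_choice)
    show "\<exists>l. fractional_signing v 0 l"
      by (intro exI[of _ "\<lambda>_. 0"]) (simp add: fractional_signing_def)
  qed (rule fractional_signing_extend)
  then obtain l where l: "\<And>n. fractional_signing v n (l n)"
    and frozen: "\<And>n i. \<bar>l n i\<bar> = 1 \<Longrightarrow> l (Suc n) i = l n i"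
    by blast
  have frozen_later: "l (n + k) i = l n i" if "\<bar>l n i\<bar> = 1" for n k i
    by (induction k) (use that frozen in auto)
  have frozen_eq: "l n i = l p i" if "\<bar>l n i\<bar> = 1" "\<bar>l p i\<bar> = 1" for n p i
    using frozen_later[OF that(1), of "p - n"] frozen_later[OF that(2), of "n - p"]
    by (cases "n \<le> p") auto
  \<comment> \<open>By \<open>frozen_eq\<close> every stage at which coordinate \<open>i\<close> is
    frozen gives the same value, so the choice made by \<open>SOME\<close> is immaterial.
    Coordinates that never freeze get the default sign 1.\<close>
  define s where "s = (\<lambda>i. if \<exists>n. \<bar>l n i\<bar> = 1 then l (SOME n. \<bar>l n i\<bar> = 1) i else 1)"
  have abs_SOME: "\<bar>l (SOME n. \<bar>l n i\<bar> = 1) i\<bar> = 1" if "\<exists>n. \<bar>l n i\<bar> = 1" for i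
    using someI_ex[OF that] .
  have abs_s: "\<bar>s i\<bar> = 1" for i
    using abs_SOME[of i] by (auto simp: s_def)
  have s_eq: "s i = l n i" if "\<bar>l n i\<bar> = 1" for n i
    using frozen_eq[OF that abs_SOME[of i]] that by (auto simp: s_def)
  have bound: "norm (\<Sum>i<n. s i *\<^sub>R v i) \<le> 2 * DIM('a) * D" for n
  proof -
    define F where "F = {i. i < n \<and> \<bar>l n i\<bar> < 1}"
    have ln: "\<And>i. \<bar>l n i\<bar> \<le> 1" "(\<Sum>i<n. l n i *\<^sub>R v i) = 0" "card F \<le> DIM('a)"
      using l[of n] by (auto simp: fractional_signing_def F_def)
    have "(\<Sum>i<n. s i *\<^sub>R v i) = (\<Sum>i<n. (s i - l n i) *\<^sub>R v i)"
      using ln by (simp add: scaleR_left_diff_distrib sum_subtractf)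
    also have "\<dots> = (\<Sum>i\<in>F. (s i - l n i) *\<^sub>R v i)"
    proof (rule sum.mono_neutral_right)
      show "\<forall>i\<in>{..<n} - F. (s i - l n i) *\<^sub>R v i = 0"
      proof
        fix i assume "i \<in> {..<n} - F"
        then have "\<bar>l n i\<bar> = 1"
          using ln(1)[of i] by (auto simp: F_def)
        then show "(s i - l n i) *\<^sub>R v i = 0"
          using s_eq by simp
      qed
    qed (auto simp: F_def)
    also have "norm \<dots> \<le> (\<Sum>i\<in>F. 2 * D)"
    proof (rule sum_norm_le)
      fix i
      have "\<bar>s i - l n i\<bar> \<le> 2"
        using abs_s[of i] ln(1)[of i] by linarith
      then show "norm ((s i - l n i) *\<^sub>R v i) \<le> 2 * D"
        using v[of i] by (simp add: mult_mono)
    qed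
    also have "\<dots> = real (card F) * (2 * D)"
      by simp
    also have "\<dots> \<le> real DIM('a) * (2 * D)"
      using ln(3) D by (intro mult_right_mono) auto
    finally show ?thesis
      by (simp add: mult_ac)
  qed
  have "s i \<in> {-1, 1}" for i
    using abs_s[of i] by (auto simp: abs_if split: if_splits)
  then show ?thesis
    using bound by (rule that)
qed

text \<open>
  The Dvoretzky--Hanani theorem: the bounded signings of stages on which
  \<open>norm (v i) \<le> (1/2) ^ r\<close> are concatenated, so that the stages contribute a convergent geometric series.
\<close>

lemma convergent_signed_series:
  fixes v :: "nat \<Rightarrow> 'a::euclidean_space"
  assumes v: "v \<longlonglongrightarrow> 0"
  obtains s :: "nat \<Rightarrow> real"
    where "\<And>i. s i \<in> {-1, 1}" and "convergent (\<lambda>n. \<Sum>i<n. s i *\<^sub>R v i)"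
proof -
  define C where "C = 2 * real DIM('a)"
  have "\<exists>N. \<forall>r::nat. (\<forall>i\<ge>N r. norm (v i) \<le> (1/2) ^ r) \<and> N r < N (Suc r)"
  proof (rule dependent_nat_choice)
    have small: "\<exists>n\<ge>k. \<forall>i\<ge>n. norm (v i) \<le> (1/2) ^ r" for k r
    proof -
      have "eventually (\<lambda>i. norm (v i) < (1/2) ^ r) sequentially"
        using order_tendstoD(2)[OF tendsto_norm[OF v], of "(1/2) ^ r"] by simp
      then obtain n where "\<And>i. i \<ge> n \<Longrightarrow> norm (v i) < (1/2) ^ r"
        by (auto simp: eventually_sequentially)
      then show ?thesis
        by (intro exI[of _ "max n k"]) (auto intro: less_imp_le)
    qed
    show "\<exists>n. \<forall>i\<ge>n. norm (v i) \<le> (1/2) ^ 0"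
      using small[of 0 0] by auto
    show "\<exists>n'. (\<forall>i\<ge>n'. norm (v i) \<le> (1/2) ^ Suc r) \<and> n < n'" for n r
      using small[of "Suc n" "Suc r"] by (auto simp: Suc_le_eq)
  qed
  then obtain N where N: "\<And>r i. i \<ge> N r \<Longrightarrow> norm (v i) \<le> (1/2) ^ r" and "\<And>r. N r < N (Suc r)"
    by blast
  then have mono: "strict_mono N"
    by (simp add: strict_mono_Suc_iff)
  have "\<exists>s. (\<forall>i. s i \<in> {-1, 1}) \<and>
      (\<forall>n. norm (\<Sum>i<n. s i *\<^sub>R v (N r + i)) \<le> C * (1/2) ^ r)" for r
  proof -
    have small: "norm (v (N r + i)) \<le> (1/2) ^ r" for i
      using N by simp
    obtain s :: "nat \<Rightarrow> real" where "\<And>i. s i \<in> {-1, 1}"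
      and "\<And>n. norm (\<Sum>i<n. s i *\<^sub>R v (N r + i)) \<le> 2 * DIM('a) * (1/2) ^ r"
      using bounded_signed_sums[of "\<lambda>i. v (N r + i)", OF small] by blast
    then show ?thesis
      unfolding C_def by (intro exI[of _ s]) simp
  qed
  then obtain S :: "nat \<Rightarrow> nat \<Rightarrow> real" where S: "\<And>r i. S r i \<in> {-1, 1}"
    and S_bound: "\<And>r n. norm (\<Sum>i<n. S r i *\<^sub>R v (N r + i)) \<le> C * (1/2) ^ r"
    by metis
  define stage where "stage = (\<lambda>i. GREATEST r. N r \<le> i)"
  \<comment> \<open>For \<open>i < N 0\<close> the stage is arbitrary, but \<open>S\<close> still
    yields a sign, and the Cauchy estimate concerns only sums starting at some
    \<open>N r\<close>.\<close>
  define s where "s = (\<lambda>i. S (stage i) (i - N (stage i)))"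
  have stage: "stage i = r" if "N r \<le> i" "i < N (Suc r)" for i r
    unfolding stage_def
  proof (rule Greatest_equality)
    show "N r \<le> i" by fact
    show "q \<le> r" if "N q \<le> i" for q
      using that \<open>i < N (Suc r)\<close> strict_mono_less[OF mono, of q "Suc r"] by auto
  qed
  have one_stage: "norm (\<Sum>i\<in>{N r..<n}. s i *\<^sub>R v i) \<le> C * (1/2) ^ r"
    if "N r \<le> n" "n \<le> N (Suc r)" for r n
  proof -
    have "(\<Sum>i\<in>{N r..<n}. s i *\<^sub>R v i) = (\<Sum>i\<in>{N r..<n}. S r (i - N r) *\<^sub>R v i)"
      by (rule sum.cong) (use that stage[of r] in \<open>auto simp: s_def\<close>)
    also have "\<dots> = (\<Sum>i<n - N r. S r i *\<^sub>R v (N r + i))"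
      by (rule sum.reindex_bij_witness[of _ "\<lambda>i. N r + i" "\<lambda>i. i - N r"]) (use that in auto)
    finally show ?thesis
      using S_bound by simp
  qed
  have C0: "C \<ge> 0" by (simp add: C_def)
  \<comment> \<open>The constant \<open>2 * C\<close> is the fixed point of the recursion: one full
    stage costs \<open>C * (1/2) ^ r\<close>, and the rest costs
    \<open>2 * C * (1/2) ^ Suc r\<close>, which is again \<open>C * (1/2) ^ r\<close>.\<close>
  have tail: "norm (\<Sum>i\<in>{N r..<n}. s i *\<^sub>R v i) \<le> 2 * C * (1/2) ^ r" if "N r \<le> n" for r n
    using that
  proof (induction "n - r" arbitrary: r rule: less_induct)
    case less
    show ?case
    proof (cases "n \<le> N (Suc r)")
      case True
      have "C * (1/2) ^ r \<ge> 0" using C0 by simp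
      then show ?thesis
        using one_stage[OF less.prems True] by linarith
    next
      case False
      \<comment> \<open>Strict monotonicity gives \<open>Suc r \<le> N (Suc r)\<close>, so
        \<open>n - r\<close> really decreases in the induction.\<close>
      have "r < n"
        using False strict_mono_imp_increasing[OF mono, of "Suc r"] by linarith
      have "(\<Sum>i\<in>{N r..<n}. s i *\<^sub>R v i) =
          (\<Sum>i\<in>{N r..<N (Suc r)}. s i *\<^sub>R v i) + (\<Sum>i\<in>{N (Suc r)..<n}. s i *\<^sub>R v i)"
        using False strict_monoD[OF mono, of r "Suc r"] by (intro sum.atLeastLessThan_concat[symmetric]) auto
      also have "norm \<dots> \<le> C * (1/2) ^ r + 2 * C * (1/2) ^ Suc r"
        using one_stage[of r "N (Suc r)"] less.hyps[of "Suc r"] False \<open>r < n\<close> strict_monoD[OF mono, of r "Suc r"]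
        by (intro norm_triangle_mono) auto
      finally show ?thesis by simp
    qed
  qed
  have "Cauchy (\<lambda>n. \<Sum>i<n. s i *\<^sub>R v i)"
  proof (rule metric_CauchyI)
    fix e :: real assume "e > 0"
    \<comment> \<open>Two partial sums beyond \<open>N r\<close> differ by two tails, each at most
      \<open>2 * C * (1/2) ^ r\<close>.\<close>
    have "(\<lambda>r. 4 * C * (1/2) ^ r) \<longlonglongrightarrow> 0"
      by (intro tendsto_mult_right_zero LIMSEQ_realpow_zero) auto
    then have "eventually (\<lambda>r. 4 * C * (1/2) ^ r < e) sequentially"
      using \<open>e > 0\<close> by (rule order_tendstoD)
    then obtain r where r: "4 * C * (1/2) ^ r < e"
      by (auto simp: eventually_sequentially)
    have split: "(\<Sum>i<n. s i *\<^sub>R v i) = (\<Sum>i<N r. s i *\<^sub>R v i) + (\<Sum>i\<in>{N r..<n}. s i *\<^sub>R v i)"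
      if "n \<ge> N r" for n
      using sum.atLeastLessThan_concat[of 0 "N r" n "\<lambda>i. s i *\<^sub>R v i"] that
      by (simp add: atLeast0LessThan)
    show "\<exists>M. \<forall>m\<ge>M. \<forall>n\<ge>M. dist (\<Sum>i<m. s i *\<^sub>R v i) (\<Sum>i<n. s i *\<^sub>R v i) < e"
    proof (intro exI[of _ "N r"] allI impI)
      fix m n assume "N r \<le> m" "N r \<le> n"
      then show "dist (\<Sum>i<m. s i *\<^sub>R v i) (\<Sum>i<n. s i *\<^sub>R v i) < e"
        unfolding dist_norm split[OF \<open>N r \<le> m\<close>] split[OF \<open>N r \<le> n\<close>]
        using tail[of r m] tail[of r n] r
          norm_triangle_ineq4[of "\<Sum>i\<in>{N r..<m}. s i *\<^sub>R v i" "\<Sum>i\<in>{N r..<n}. s i *\<^sub>R v i"]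
        by simp
    qed
  qed
  then show ?thesis
    using S by (intro that[of s]) (auto simp: s_def Cauchy_convergent_iff)
qed

text \<open>
  The signs of the blocks come from the Dvoretzky--Hanani theorem for the series of block sums.
\<close>

lemma convergent_signed_series_blocks:
  fixes a :: "nat \<Rightarrow> 'a::euclidean_space" and h :: "nat \<Rightarrow> real"
  assumes a: "a \<longlonglongrightarrow> 0" and "m > 0" and h: "\<And>n. \<bar>h n\<bar> \<le> 1"
  obtains s :: "nat \<Rightarrow> real"
    where "\<And>j. s j \<in> {-1, 1}" and "convergent (\<lambda>N. \<Sum>n<N. (s (n div m) * h n) *\<^sub>R a n)"
proof -
  define b where "b = (\<lambda>j. \<Sum>n\<in>{j * m..<j * m + m}. h n *\<^sub>R a n)"
  \<comment> \<open>\<open>g j\<close> bounds both the full block sum \<open>b j\<close> and any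
    initial piece of block \<open>j\<close>. It therefore also controls the incomplete last block of
    a partial sum, and it tends to 0 as a sum of the fixed number \<open>m\<close> of null
    sequences.\<close>
  define g where "g = (\<lambda>j. \<Sum>n\<in>{j * m..<j * m + m}. norm (a n))"
  have "(\<lambda>j. \<Sum>i<m. norm (a (j * m + i))) \<longlonglongrightarrow> (\<Sum>i<m. 0)"
  proof (rule tendsto_sum)
    fix i
    have "filterlim (\<lambda>j. j * m + i) sequentially sequentially"
      using \<open>m > 0\<close> by (intro filterlim_subseq) (simp add: strict_mono_def)
    from filterlim_compose[OF a this] show "(\<lambda>j. norm (a (j * m + i))) \<longlonglongrightarrow> 0"
      by (rule tendsto_norm_zero)
  qed
  moreover have "g = (\<lambda>j. \<Sum>i<m. norm (a (j * m + i)))"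
  proof
    fix j
    show "g j = (\<Sum>i<m. norm (a (j * m + i)))"
      unfolding g_def
      by (rule sum.reindex_bij_witness[of _ "\<lambda>i. j * m + i" "\<lambda>n. n - j * m"]) auto
  qed
  ultimately have g: "g \<longlonglongrightarrow> 0" by simp
  have term_le: "norm ((c * h n) *\<^sub>R a n) \<le> norm (a n)" if "\<bar>c\<bar> = 1" for c n
    using h[of n] that by (simp add: abs_mult mult_left_le_one_le)
  have "norm (b j) \<le> g j" for j
    unfolding b_def g_def using term_le[of 1] by (intro sum_norm_le) simp
  then have "b \<longlonglongrightarrow> 0"
    by (intro Lim_null_comparison[OF _ g]) auto
  then obtain s :: "nat \<Rightarrow> real" where s: "\<And>j. s j \<in> {-1, 1}" and "convergent (\<lambda>J. \<Sum>j<J. s j *\<^sub>R b j)"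
    using convergent_signed_series by blast
  then obtain L where L: "(\<lambda>J. \<Sum>j<J. s j *\<^sub>R b j) \<longlonglongrightarrow> L"
    by (auto simp: convergent_def)
  define f where "f = (\<lambda>n. (s (n div m) * h n) *\<^sub>R a n)"
  have block: "(\<Sum>n\<in>{j * m..<j * m + m}. f n) = s j *\<^sub>R b j" for j
    unfolding b_def f_def scaleR_sum_right
  proof (rule sum.cong)
    fix n assume n: "n \<in> {j * m..<j * m + m}"
    then have "n div m = j"
      by (intro div_nat_eqI) (auto simp: mult.commute)
    then show "(s (n div m) * h n) *\<^sub>R a n = s j *\<^sub>R h n *\<^sub>R a n" by simp
  qed simp
  have dm: "filterlim (\<lambda>N. N div m) sequentially sequentially"
    unfolding filterlim_at_top eventually_sequentially
    using \<open>m > 0\<close> by (metis div_le_mono nonzero_mult_div_cancel_right less_not_refl2)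
  have rest: "norm ((\<Sum>n<N. f n) - (\<Sum>j<N div m. s j *\<^sub>R b j)) \<le> g (N div m)" for N
  proof -
    have N: "N div m * m \<le> N" "N \<le> N div m * m + m"
      using mod_less_divisor[OF \<open>m > 0\<close>, of N] div_mult_mod_eq[of N m] by linarith+
    have "(\<Sum>n<N. f n) = (\<Sum>n<N div m * m. f n) + (\<Sum>n\<in>{N div m * m..<N}. f n)"
      using sum.atLeastLessThan_concat[of 0 "N div m * m" N f] N by (simp add: atLeast0LessThan)
    moreover have "(\<Sum>n<N div m * m. f n) = (\<Sum>j<N div m. s j *\<^sub>R b j)"
      by (simp flip: sum.nat_group add: block)
    ultimately have "norm ((\<Sum>n<N. f n) - (\<Sum>j<N div m. s j *\<^sub>R b j)) = norm (\<Sum>n\<in>{N div m * m..<N}. f n)"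
      by simp
    also have "\<dots> \<le> (\<Sum>n\<in>{N div m * m..<N}. norm (a n))"
    proof (rule sum_norm_le)
      fix n
      have "\<bar>s (n div m)\<bar> = 1" using s[of "n div m"] by auto
      then show "norm (f n) \<le> norm (a n)"
        using term_le[of "s (n div m)" n] by (simp add: f_def)
    qed
    also have "\<dots> \<le> g (N div m)"
      unfolding g_def using N by (intro sum_mono2) auto
    finally show ?thesis .
  qed
  have "(\<lambda>N. (\<Sum>n<N. f n) - (\<Sum>j<N div m. s j *\<^sub>R b j)) \<longlonglongrightarrow> 0"
    using rest by (intro Lim_null_comparison[OF _ filterlim_compose[OF g dm]]) auto
  from tendsto_add[OF this filterlim_compose[OF L dm]] have "(\<lambda>N. \<Sum>n<N. f n) \<longlonglongrightarrow> L"
    by simp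
  then show ?thesis
    using s by (intro that[of s]) (auto simp: f_def convergent_def)
qed

section \<open>Hausdorff measure on the space of sign sequences\<close>

definition cylinder :: "nat \<Rightarrow> (nat \<Rightarrow> real) \<Rightarrow> sign_seq set" where
  "cylinder n c = {y. \<forall>i\<in>{1..n}. sgn_at y i = c i}"

lemma sgn_at_sign: "i \<ge> 1 \<Longrightarrow> sgn_at x i \<in> {-1, 1}"
  using sgn_at[of x] by (auto simp: PiE_def Pi_def)

text \<open>Open balls of radius \<open>(1/2) ^ n\<close> are cylinders of length \<open>n\<close>:
  the distance is below this radius exactly when the first disagreement comes after index
  \<open>n\<close>.\<close>

lemma dist_less_power_iff: "dist x y < (1/2) ^ n \<longleftrightarrow> y \<in> cylinder n (sgn_at x)"
proof (cases "x = y")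
  case True
  then show ?thesis by (simp add: cylinder_def)
next
  case False
  define L where "L = (LEAST i. 1 \<le> i \<and> sgn_at x i \<noteq> sgn_at y i)"
  have "\<exists>i. 1 \<le> i \<and> sgn_at x i \<noteq> sgn_at y i"
    using False by (auto simp: sign_seq_eq_iff)
  from LeastI_ex[OF this] have L: "1 \<le> L" "sgn_at x L \<noteq> sgn_at y L"
    by (auto simp: L_def)
  have before_L: "sgn_at x i = sgn_at y i" if "1 \<le> i" "i < L" for i
    using not_less_Least[of i] that by (auto simp: L_def)
  have "dist x y < (1/2) ^ n \<longleftrightarrow> n < L"
    using False by (simp add: dist_sign_seq_def L_def power_strict_decreasing_iff)
  also have "\<dots> \<longleftrightarrow> y \<in> cylinder n (sgn_at x)"
  proof
    show "y \<in> cylinder n (sgn_at x)" if "n < L"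
      using before_L that by (simp add: cylinder_def)
    show "n < L" if "y \<in> cylinder n (sgn_at x)"
    proof (rule ccontr)
      assume "\<not> n < L"
      then have "L \<in> {1..n}" using L(1) by simp
      with that have "sgn_at y L = sgn_at x L"
        unfolding cylinder_def by blast
      with L(2) show False by simp
    qed
  qed
  finally show ?thesis .
qed

lemma bounded_sign_seq: "bounded (A :: sign_seq set)"
proof -
  have "dist x y \<le> 1" for x y :: sign_seq
    using dist_less_power_iff[of x y 0] by (simp add: cylinder_def)
  then show ?thesis
    unfolding bounded_def by blast
qed

lemma diameter_cylinder_le: "diameter (cylinder n c) \<le> (1/2) ^ n"
proof -
  have "dist x y \<le> (1/2) ^ n" if "x \<in> cylinder n c" "y \<in> cylinder n c" for x y
    using that by (intro less_imp_le) (simp add: dist_less_power_iff, simp add: cylinder_def)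
  then show ?thesis
    unfolding diameter_def by (auto intro!: cSUP_least)
qed

lemma card_sign_functions: "finite I \<Longrightarrow> card (I \<rightarrow>\<^sub>E {-1, 1::real}) = 2 ^ card I"
  by (simp add: card_PiE numeral_2_eq_2)

text \<open>The whole space is covered by the at most \<open>2 ^ n\<close> cylinders given by sign
  patterns of length \<open>n\<close>, each of diameter at most \<open>(1/2) ^ n\<close>; the
  enumeration is padded with empty sets of weight 0.\<close>

lemma hausdorff_premeasure_le_cylinders:
  assumes "s > 0" and "(1/2) ^ n \<le> \<delta>"
  shows "hausdorff_premeasure s \<delta> (A :: sign_seq set) \<le> ennreal (2 ^ n * ((1/2) ^ n) powr s)"
proof -
  define W where "W = ((1/2) ^ n) powr s"
  have "W \<ge> 0" by (simp add: W_def)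
  define K where "K = cylinder n ` ({1..n} \<rightarrow>\<^sub>E {-1, 1})"
  have fin: "finite K" by (simp add: K_def finite_PiE)
  have card: "card K \<le> 2 ^ n"
    using card_image_le[of "{1..n} \<rightarrow>\<^sub>E {-1, 1::real}" "cylinder n"]
    by (simp add: K_def card_sign_functions finite_PiE)
  obtain h where h: "bij_betw h {0..<card K} K"
    using ex_bij_betw_nat_finite[OF fin] by blast
  define U where "U = (\<lambda>i. if i < card K then h i else {})"
  have UK: "U i \<in> K" if "i < card K" for i
    using that bij_betwE[OF h] by (auto simp: U_def)
  have diam: "diameter (U i) \<le> (1/2) ^ n" for i
    using UK[of i] diameter_cylinder_le by (auto simp: K_def U_def split: if_splits)
  have "x \<in> (\<Union>i. U i)" for x
  proof -
    have x: "x \<in> cylinder n (restrict (sgn_at x) {1..n})"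
      by (simp add: cylinder_def)
    have "cylinder n (restrict (sgn_at x) {1..n}) \<in> K"
      unfolding K_def by (intro imageI restrict_PiE_iff[THEN iffD2] ballI sgn_at_sign) simp
    then have "cylinder n (restrict (sgn_at x) {1..n}) \<in> h ` {0..<card K}"
      by (simp only: bij_betw_imp_surj_on[OF h])
    then obtain i where "i < card K" "cylinder n (restrict (sgn_at x) {1..n}) = h i"
      by auto
    then have "x \<in> U i"
      using x by (simp add: U_def)
    then show ?thesis by blast
  qed
  then have "A \<subseteq> (\<Union>i. U i)" by blast
  moreover have "diameter (U i) \<le> \<delta>" for i
    using assms(2) diam[of i] by linarith
  ultimately have "hausdorff_cover \<delta> A U"
    using bounded_sign_seq unfolding hausdorff_cover_def by blast
  then have "hausdorff_premeasure s \<delta> A \<le> (\<Sum>i. ennreal (hausdorff_weight s (U i)))"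
    unfolding hausdorff_premeasure_def by (intro INF_lower) simp
  also have "\<dots> = (\<Sum>i<card K. ennreal (hausdorff_weight s (U i)))"
    by (rule suminf_finite) (auto simp: U_def hausdorff_weight_def)
  also have "\<dots> \<le> (\<Sum>i<card K. ennreal W)"
  proof (intro sum_mono ennreal_leI)
    fix i
    have "diameter (U i) powr s \<le> W"
      unfolding W_def using assms(1) diam diameter_ge_0[OF bounded_sign_seq]
      by (intro powr_mono2) auto
    then show "hausdorff_weight s (U i) \<le> W"
      using assms(1) \<open>W \<ge> 0\<close> by (simp add: hausdorff_weight_def)
  qed
  also have "\<dots> = ennreal (real (card K) * W)"
    using \<open>W \<ge> 0\<close> by (simp add: ennreal_mult ennreal_of_nat_eq_real_of_nat)
  also have "\<dots> \<le> ennreal (2 ^ n * W)"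
    using of_nat_mono[OF card, where 'a = real] \<open>W \<ge> 0\<close>
    by (intro ennreal_leI mult_right_mono) auto
  finally show ?thesis
    by (simp add: W_def)
qed

text \<open>For fixed \<open>\<delta>\<close> the cylinder bound holds for all large
  \<open>n\<close> and equals the \<open>n\<close>-th power of \<open>(1/2) powr (s - 1)\<close>,
  which is less than 1.\<close>

lemma hausdorff_measure_sign_seq_eq_0:
  assumes "s > 1"
  shows "hausdorff_measure s (A :: sign_seq set) = 0"
proof -
  have "hausdorff_premeasure s \<delta> A \<le> 0" if "\<delta> > 0" for \<delta>
  proof (rule tendsto_lowerbound)
    have eq: "2 ^ n * ((1/2) ^ n) powr s = ((1/2) powr (s - 1)) ^ n" for n
    proof -
      have "((1/2) ^ n) powr s = ((1/2) powr s) ^ n"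
        by (simp add: powr_realpow[symmetric] powr_powr mult.commute)
      moreover have "(1/2) powr (s - 1) = 2 * (1/2) powr s"
        by (simp add: powr_diff)
      ultimately show ?thesis
        by (simp add: power_mult_distrib)
    qed
    have "(1/2) powr (s - 1) < 1"
      using assms powr_less_mono'[of "1/2" 0 "s - 1"] by simp
    then have "(\<lambda>n. ((1/2) powr (s - 1)) ^ n) \<longlonglongrightarrow> 0"
      by (intro LIMSEQ_realpow_zero) auto
    then show "(\<lambda>n. ennreal (2 ^ n * ((1/2) ^ n) powr s)) \<longlonglongrightarrow> 0"
      unfolding eq ennreal_0[symmetric] by (intro tendsto_ennrealI)
    have "(\<lambda>n. (1/2 :: real) ^ n) \<longlonglongrightarrow> 0"
      by (intro LIMSEQ_realpow_zero) auto
    then have "eventually (\<lambda>n. (1/2) ^ n < \<delta>) sequentially"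
      using that by (rule order_tendstoD)
    then show "eventually (\<lambda>n. hausdorff_premeasure s \<delta> A \<le> ennreal (2 ^ n * ((1/2) ^ n) powr s)) sequentially"
      by eventually_elim (use assms in \<open>auto intro!: hausdorff_premeasure_le_cylinders\<close>)
  qed simp
  then show ?thesis
    unfolding hausdorff_measure_def by (simp add: SUP_eq_iff bot_ennreal le_zero_eq)
qed

lemma hausdorff_dim_sign_seq_le_1: "hausdorff_dim (A :: sign_seq set) \<le> 1"
proof (rule ennreal_le_epsilon)
  fix e :: real assume "e > 0"
  then have "hausdorff_dim A \<le> ennreal (1 + e)"
    unfolding hausdorff_dim_def by (intro INF_lower) (simp add: hausdorff_measure_sign_seq_eq_0)
  then show "hausdorff_dim A \<le> 1 + ennreal e"
    using \<open>e > 0\<close> by (simp add: ennreal_plus)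
qed

text \<open>
  The index is chosen so that \<open>(1/2) ^ n\<close> is comparable to the diameter of \<open>U\<close>. The error term is
  needed only for one-point sets, which have weight 0 when \<open>s > 0\<close>.
\<close>

lemma subset_small_cylinder:
  assumes "x \<in> U" and diam: "diameter U \<le> 1/2" and s: "0 \<le> s" "s \<le> 1" and "e > 0"
  shows "\<exists>n. U \<subseteq> cylinder n (sgn_at x) \<and> (1/2) powr (real n * s) \<le> 2 * hausdorff_weight s U + e"
proof -
  have dist_le: "dist x y \<le> diameter U" if "y \<in> U" for y
    using diameter_bounded_bound[OF bounded_sign_seq assms(1) that] .
  consider "s = 0" | "s > 0" "diameter U \<le> 0" | "s > 0" "diameter U > 0"
    using s(1) by linarith
  then show ?thesis
  proof cases
    \<comment> \<open>Here the nonempty set \<open>U\<close> has weight 1, so the cylinder of length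
      0, the whole space, is good enough.\<close>
    case 1
    then show ?thesis
      using assms(1) \<open>e > 0\<close> by (intro exI[of _ 0]) (auto simp: cylinder_def hausdorff_weight_def)
  next
    case 2
    have "(1/2) powr s < 1"
      using 2 powr_less_mono'[of "1/2" 0 s] by simp
    then obtain n where "((1/2) powr s) ^ n < e"
      using real_arch_pow_inv[OF \<open>e > 0\<close>] by blast
    then have "(1/2) powr (real n * s) < e"
      by (simp add: powr_realpow[symmetric] powr_powr mult.commute)
    moreover have "y = x" if "y \<in> U" for y
      using dist_le[OF that] 2 by (metis dist_le_zero_iff order_trans)
    moreover have "hausdorff_weight s U \<ge> 0"
      by (simp add: hausdorff_weight_def)
    ultimately show ?thesis
      by (intro exI[of _ n]) (force simp: cylinder_def)
  next
    case 3
    \<comment> \<open>The index wanted is \<open>k - 1\<close>: minimality gives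
      \<open>diameter U < (1/2) ^ (k - 1)\<close>, while
      \<open>(1/2) ^ (k - 1) = 2 * (1/2) ^ k\<close> is at most \<open>2 * diameter U\<close>. The
      assumption \<open>diameter U \<le> 1/2\<close> excludes \<open>k = 0\<close>.\<close>
    define k where "k = (LEAST k. (1/2) ^ k \<le> diameter U)"
    have "\<exists>k. (1/2) ^ k \<le> diameter U"
      using real_arch_pow_inv[OF 3(2), of "1/2"] by (auto intro: less_imp_le)
    from LeastI_ex[OF this] have k: "(1/2) ^ k \<le> diameter U"
      by (simp add: k_def)
    then have "k \<noteq> 0"
      using diam by (auto intro: ccontr)
    then obtain n where n: "k = Suc n"
      by (cases k) auto
    have "diameter U < (1/2) ^ n"
      using not_less_Least[of n "\<lambda>k. (1/2) ^ k \<le> diameter U"] n by (simp add: k_def)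
    then have "U \<subseteq> cylinder n (sgn_at x)"
      using dist_le dist_less_power_iff[of x _ n] by fastforce
    moreover have "(1/2) powr (real n * s) \<le> 2 * diameter U powr s"
    proof -
      have "(1/2) powr (real n * s) = ((1/2) ^ n) powr s"
        by (simp add: powr_realpow[symmetric] powr_powr)
      also have "\<dots> \<le> (2 * diameter U) powr s"
        using k n s by (intro powr_mono2) auto
      also have "\<dots> = 2 powr s * diameter U powr s"
        using 3 by (simp add: powr_mult)
      also have "\<dots> \<le> 2 * diameter U powr s"
        using powr_mono[of s 1 2] s by (intro mult_right_mono) auto
      finally show ?thesis .
    qed
    ultimately show ?thesis
      using 3 assms(1) \<open>e > 0\<close> by (intro exI[of _ n]) (auto simp: hausdorff_weight_def)
  qed
qed

section \<open>Coin tossing measure and block corrections\<close>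

text \<open>Placed on extensional functions, where the product measure is available; its space is
  exactly the set representing \<open>sign_seq\<close>.\<close>

abbreviation coin_tosses :: "(nat \<Rightarrow> real) measure" where
  "coin_tosses \<equiv> PiM {1..} (\<lambda>_. uniform_count_measure {-1, 1})"

lemma space_coin_tosses: "space coin_tosses = {1..} \<rightarrow>\<^sub>E {-1, 1}"
  by (simp add: space_PiM space_uniform_count_measure)

lemma prob_space_coin_tosses: "prob_space coin_tosses"
  by (intro prob_space_PiM prob_space_uniform_count_measure) auto

lemma coin_tosses_cylinder:
  assumes "\<And>i. i \<in> {1..n} \<Longrightarrow> c i \<in> {-1, 1}"
  shows "{h \<in> space coin_tosses. \<forall>i\<in>{1..n}. h i = c i} \<in> sets coin_tosses"
    and "emeasure coin_tosses {h \<in> space coin_tosses. \<forall>i\<in>{1..n}. h i = c i} = ennreal ((1/2) ^ n)"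
proof -
  interpret product_prob_space "\<lambda>_::nat. uniform_count_measure {-1, 1::real}" "{1..}"
    by (intro product_prob_spaceI prob_space_uniform_count_measure) auto
  have "emeasure coin_tosses {h \<in> space coin_tosses. \<forall>i\<in>{1..n}. h i \<in> {c i}} =
      (\<Prod>i\<in>{1..n}. emeasure (uniform_count_measure {-1, 1}) {c i})"
    using assms by (intro emeasure_PiM_Collect) (auto simp: sets_uniform_count_measure)
  also have "\<dots> = (\<Prod>i\<in>{1..n}. ennreal (1/2))"
    using assms by (intro prod.cong) (auto simp: emeasure_uniform_count_measure)
  also have "\<dots> = ennreal (\<Prod>i\<in>{1..n}. 1/2)"
    by (rule prod_ennreal) simp
  finally show *: "emeasure coin_tosses {h \<in> space coin_tosses. \<forall>i\<in>{1..n}. h i = c i} = ennreal ((1/2) ^ n)"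
    by simp
  \<comment> \<open>\<open>emeasure\<close> is 0 outside the sigma-algebra, so a set of measure
    \<open>(1/2) ^ n\<close> must be measurable.\<close>
  then show "{h \<in> space coin_tosses. \<forall>i\<in>{1..n}. h i = c i} \<in> sets coin_tosses"
    using emeasure_notin_sets by fastforce
qed

text \<open>The sequences that some choice of block signs can bring into
  \<open>cylinder n c\<close>. Indices up to \<open>n\<close> meet only blocks \<open>0\<close> to
  \<open>n div m\<close>, so finitely many sign choices suffice.\<close>

definition block_flips :: "nat \<Rightarrow> nat \<Rightarrow> (nat \<Rightarrow> real) \<Rightarrow> (nat \<Rightarrow> real) set" where
  "block_flips m n c = (\<Union>s\<in>{..n div m} \<rightarrow>\<^sub>E {-1, 1}.
     {h \<in> space coin_tosses. \<forall>i\<in>{1..n}. h i = s (i div m) * c i})"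

text \<open>A union bound over \<open>2 ^ (n div m + 1)\<close> cylinders of measure
  \<open>(1/2) ^ n\<close>, combined with
  \<open>n div m \<le> n / m \<le> n * (1 - t)\<close>.\<close>

lemma block_flips_measure:
  assumes c: "\<And>i. i \<in> {1..n} \<Longrightarrow> c i \<in> {-1, 1}" and m: "m > 0" "1 / real m \<le> 1 - t"
  shows "block_flips m n c \<in> sets coin_tosses"
    and "emeasure coin_tosses (block_flips m n c) \<le> ennreal (2 * (1/2) powr (real n * t))"
proof -
  define S where "S = {..n div m} \<rightarrow>\<^sub>E {-1, 1::real}"
  have fin: "finite S" by (simp add: S_def finite_PiE)
  have sc: "s (i div m) * c i \<in> {-1, 1}" if "s \<in> S" "i \<in> {1..n}" for s i
  proof -
    have "s (i div m) \<in> {-1, 1}"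
      using that by (auto simp: S_def PiE_def Pi_def div_le_mono)
    then show ?thesis using c[OF that(2)] by auto
  qed
  have cyl: "{h \<in> space coin_tosses. \<forall>i\<in>{1..n}. h i = s (i div m) * c i} \<in> sets coin_tosses"
    "emeasure coin_tosses {h \<in> space coin_tosses. \<forall>i\<in>{1..n}. h i = s (i div m) * c i} = ennreal ((1/2) ^ n)"
    if "s \<in> S" for s
    using coin_tosses_cylinder[of n "\<lambda>i. s (i div m) * c i", OF sc[OF that]] by blast+
  show "block_flips m n c \<in> sets coin_tosses"
    unfolding block_flips_def S_def[symmetric] using fin cyl(1) by (intro sets.finite_UN) auto
  have "emeasure coin_tosses (block_flips m n c)
      \<le> (\<Sum>s\<in>S. emeasure coin_tosses {h \<in> space coin_tosses. \<forall>i\<in>{1..n}. h i = s (i div m) * c i})"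
    unfolding block_flips_def S_def[symmetric] using fin cyl(1)
    by (intro emeasure_subadditive_finite) auto
  also have "\<dots> = (\<Sum>s\<in>S. ennreal ((1/2) ^ n))"
    using cyl(2) by (intro sum.cong) auto
  also have "\<dots> = ennreal (real (card S) * (1/2) ^ n)"
    by (simp add: ennreal_mult ennreal_of_nat_eq_real_of_nat)
  also have "\<dots> \<le> ennreal (2 * (1/2) powr (real n * t))"
  proof (rule ennreal_leI)
    have "real (n div m) \<le> real n * (1 / real m)"
      using of_nat_div_le_of_nat[of n m] by simp
    also have "\<dots> \<le> real n * (1 - t)"
      using m(2) by (intro mult_left_mono) auto
    finally have le: "real (n div m) - real n \<le> - (real n * t)"
      by (simp add: algebra_simps)
    have "real (card S) * (1/2) ^ n = 2 * (2 powr real (n div m) * 2 powr (- real n))"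
      by (simp add: S_def card_sign_functions powr_realpow powr_minus power_divide field_simps)
    also have "2 powr real (n div m) * 2 powr (- real n) = 2 powr (real (n div m) - real n)"
      by (simp flip: powr_add)
    also have "\<dots> \<le> 2 powr (- (real n * t))"
      using le by (intro powr_mono) auto
    also have "\<dots> = (1/2) powr (real n * t)"
      by (simp add: powr_minus powr_divide field_simps)
    finally show "real (card S) * (1/2) ^ n \<le> 2 * (1/2) powr (real n * t)"
      by simp
  qed
  finally show "emeasure coin_tosses (block_flips m n c) \<le> ennreal (2 * (1/2) powr (real n * t))" .
qed

text \<open>The correction is a relation, so no choice of the corrected sequence has to be fixed.
  Block 0 has only the indices \<open>1\<close> to \<open>m - 1\<close>.\<close>

definition equal_up_to_block_signs :: "nat \<Rightarrow> (nat \<Rightarrow> real) \<Rightarrow> sign_seq \<Rightarrow> bool" where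
  "equal_up_to_block_signs m h x \<longleftrightarrow>
     (\<exists>s. (\<forall>j. s j \<in> {-1, 1}) \<and> (\<forall>i\<ge>1. sgn_at x i = s (i div m) * h i))"

text \<open>A sign is its own inverse, so the signs that carry \<open>h\<close> to \<open>x\<close>
  also carry the prescribed values \<open>c\<close> back to \<open>h\<close>.\<close>

lemma mem_block_flips:
  assumes h: "h \<in> space coin_tosses" and x: "x \<in> cylinder n c" and "equal_up_to_block_signs m h x"
  shows "h \<in> block_flips m n c"
proof -
  obtain s :: "nat \<Rightarrow> real" where s: "\<And>j. s j \<in> {-1, 1}"
    and xh: "\<And>i. i \<ge> 1 \<Longrightarrow> sgn_at x i = s (i div m) * h i"
    using assms(3) unfolding equal_up_to_block_signs_def by blast
  have "h i = restrict s {..n div m} (i div m) * c i" if "i \<in> {1..n}" for i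
  proof -
    have "c i = s (i div m) * h i"
      using x xh[of i] that by (auto simp: cylinder_def)
    moreover have "s (i div m) * s (i div m) = 1"
      using s[of "i div m"] by auto
    ultimately show ?thesis
      using that by (simp add: div_le_mono flip: mult.assoc)
  qed
  then show ?thesis
    unfolding block_flips_def using s h by (intro UN_I[of "restrict s {..n div m}"]) auto
qed

text \<open>Enclose \<open>U\<close> in a cylinder of comparable size and bound the sequences
  correctable into it. The constant 4 combines the factor 2 of the enclosure with the factor 2 of
  \<open>block_flips_measure\<close>.\<close>

lemma preimage_measure_le_weight:
  assumes "diameter U \<le> 1/2" and t: "0 \<le> t" "t < 1" and m: "m > 0" "1 / real m \<le> 1 - t" and "e > 0"
  shows "\<exists>B\<in>sets coin_tosses. emeasure coin_tosses B \<le> ennreal (4 * hausdorff_weight t U + 2 * e) \<and>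
    {h \<in> space coin_tosses. \<exists>x\<in>U. equal_up_to_block_signs m h x} \<subseteq> B"
proof (cases "U = {}")
  case True
  then show ?thesis by (intro bexI[of _ "{}"]) auto
next
  case False
  then obtain x where x: "x \<in> U" by auto
  obtain n where n: "U \<subseteq> cylinder n (sgn_at x)"
      "(1/2) powr (real n * t) \<le> 2 * hausdorff_weight t U + e"
    using subset_small_cylinder[OF x assms(1) t(1) less_imp_le[OF t(2)] \<open>e > 0\<close>] by blast
  let ?B = "block_flips m n (sgn_at x)"
  have sgn: "sgn_at x i \<in> {-1, 1}" if "i \<in> {1..n}" for i
    using that by (intro sgn_at_sign) simp
  have "emeasure coin_tosses ?B \<le> ennreal (2 * (1/2) powr (real n * t))"
    by (rule block_flips_measure(2)[OF sgn m])
  also have "\<dots> \<le> ennreal (4 * hausdorff_weight t U + 2 * e)"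
    using n(2) by (intro ennreal_leI) simp
  finally have "emeasure coin_tosses ?B \<le> ennreal (4 * hausdorff_weight t U + 2 * e)" .
  moreover have "{h \<in> space coin_tosses. \<exists>x\<in>U. equal_up_to_block_signs m h x} \<subseteq> ?B"
    using n(1) mem_block_flips by blast
  ultimately show ?thesis
    using block_flips_measure(1)[of n "sgn_at x", OF sgn m] by (intro bexI[of _ ?B] conjI)
qed

text \<open>
  The mass distribution principle for the possibly non-measurable correction map \<open>h \<mapsto> x\<close>:
  the preimage of a cylinder of length \<open>n\<close> lies in a union of \<open>2 ^ (n div m + 1)\<close> cylinders of the
  same length, which is measurable.
\<close>

lemma hausdorff_measure_nonzero:
  assumes t: "0 \<le> t" "t < 1" and m: "m > 0" "1 / real m \<le> 1 - t"
    and E: "\<And>h. h \<in> {1..} \<rightarrow>\<^sub>E {-1, 1} \<Longrightarrow> \<exists>x\<in>E. equal_up_to_block_signs m h x"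
  shows "hausdorff_measure t E \<noteq> 0"
proof
  assume "hausdorff_measure t E = 0"
  interpret P: prob_space coin_tosses
    by (rule prob_space_coin_tosses)
  \<comment> \<open>The errors sum to 1/16. With total weight below 1/16 the preimages have measure
    at most 4/16 + 2/16 = 3/8, too little to cover a probability space.\<close>
  define e :: "nat \<Rightarrow> real" where "e = (\<lambda>i. (1/16) * (1/2) ^ Suc i)"
  have "hausdorff_premeasure t (1/2) E \<le> hausdorff_measure t E"
    unfolding hausdorff_measure_def by (intro SUP_upper) auto
  then have "hausdorff_premeasure t (1/2) E < ennreal (1/16)"
    using \<open>hausdorff_measure t E = 0\<close> by simp
  then obtain U where U: "hausdorff_cover (1/2) E U"
    and small: "(\<Sum>i. ennreal (hausdorff_weight t (U i))) < ennreal (1/16)"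
    unfolding hausdorff_premeasure_def by (auto simp: INF_less_iff)
  have w0: "hausdorff_weight t (U i) \<ge> 0" for i
    by (simp add: hausdorff_weight_def)
  have e0: "e i > 0" for i
    by (simp add: e_def)
  have "diameter (U i) \<le> 1/2" for i
    using U by (auto simp: hausdorff_cover_def)
  then have "\<exists>B\<in>sets coin_tosses. emeasure coin_tosses B \<le> ennreal (4 * hausdorff_weight t (U i) + 2 * e i) \<and>
      {h \<in> space coin_tosses. \<exists>x\<in>U i. equal_up_to_block_signs m h x} \<subseteq> B" for i
    using e0 by (intro preimage_measure_le_weight t m)
  then have "\<forall>i. \<exists>B. B \<in> sets coin_tosses \<and>
      emeasure coin_tosses B \<le> ennreal (4 * hausdorff_weight t (U i) + 2 * e i) \<and>
      {h \<in> space coin_tosses. \<exists>x\<in>U i. equal_up_to_block_signs m h x} \<subseteq> B"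
    by blast
  from choice[OF this] obtain B where B: "\<And>i. B i \<in> sets coin_tosses"
      "\<And>i. emeasure coin_tosses (B i) \<le> ennreal (4 * hausdorff_weight t (U i) + 2 * e i)"
    and B_mem: "\<And>i. {h \<in> space coin_tosses. \<exists>x\<in>U i. equal_up_to_block_signs m h x} \<subseteq> B i"
    by blast
  have "space coin_tosses \<subseteq> (\<Union>i. B i)"
  proof
    fix h assume h: "h \<in> space coin_tosses"
    then obtain x where x: "x \<in> E" "equal_up_to_block_signs m h x"
      using E unfolding space_coin_tosses by blast
    moreover obtain i where "x \<in> U i"
      using U x(1) by (auto simp: hausdorff_cover_def)
    ultimately show "h \<in> (\<Union>i. B i)"
      using B_mem[of i] h by blast
  qed
  then have "emeasure coin_tosses (space coin_tosses) \<le> emeasure coin_tosses (\<Union>i. B i)"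
    using B(1) by (intro emeasure_mono) auto
  also have "\<dots> \<le> (\<Sum>i. emeasure coin_tosses (B i))"
    using B(1) by (intro emeasure_subadditive_countably) auto
  also have "\<dots> \<le> (\<Sum>i. 4 * ennreal (hausdorff_weight t (U i)) + ennreal (2 * e i))"
    using B(2) w0 e0[THEN less_imp_le] by (intro suminf_le) (auto simp: ennreal_plus ennreal_mult)
  also have "\<dots> = 4 * (\<Sum>i. ennreal (hausdorff_weight t (U i))) + (\<Sum>i. ennreal (2 * e i))"
    by (simp add: suminf_add[symmetric] ennreal_suminf_cmult)
  also have "(\<Sum>i. ennreal (2 * e i)) = ennreal (1/8)"
  proof -
    have "(\<lambda>i. (1/8) * (1/2) ^ Suc i) sums ((1/8) * (1::real))"
      by (intro sums_mult power_half_series)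
    then have "(\<lambda>i. 2 * e i) sums (1/8)"
      by (simp add: e_def)
    then show ?thesis
      using e0[THEN less_imp_le] by (intro suminf_ennreal_eq) auto
  qed
  also have "4 * (\<Sum>i. ennreal (hausdorff_weight t (U i))) + ennreal (1/8) \<le> 4 * ennreal (1/16) + ennreal (1/8)"
    using small by (intro add_mono mult_left_mono) auto
  also have "\<dots> = ennreal (3/8)"
    by (simp add: ennreal_plus[symmetric] ennreal_mult'[symmetric] flip: ennreal_numeral)
  finally have "1 \<le> ennreal (3/8)"
    unfolding P.emeasure_space_1 .
  then show False
    by (simp flip: ennreal_1)
qed

section \<open>Correcting sequences to convergence, and the dimension\<close>

lemma exists_convergent_equal_up_to_block_signs:
  fixes a :: "nat \<Rightarrow> 'a::euclidean_space"
  assumes a: "a \<longlonglongrightarrow> 0" and m: "m > 0" and h: "h \<in> {1..} \<rightarrow>\<^sub>E {-1, 1}"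
  obtains x where "convergent (\<lambda>N. \<Sum>n = 1..N. sgn_at x n *\<^sub>R a n)" and "equal_up_to_block_signs m h x"
proof -
  \<comment> \<open>The block lemma sums from index 0, the series from index 1. The value 0 at index
    0 removes the extra term without shifting the blocks.\<close>
  define g where "g = (\<lambda>n. if n = 0 then 0 else h n)"
  have h_sign: "h n \<in> {-1, 1}" if "n \<ge> 1" for n
    using PiE_mem[OF h] that by simp
  have "\<bar>g n\<bar> \<le> 1" for n
    using h_sign[of n] by (cases "n = 0") (auto simp: g_def)
  then obtain s :: "nat \<Rightarrow> real" where s: "\<And>j. s j \<in> {-1, 1}"
    and conv: "convergent (\<lambda>N. \<Sum>n<N. (s (n div m) * g n) *\<^sub>R a n)"
    using convergent_signed_series_blocks[OF a m, of g] by blast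
  define x where "x = Abs_sign_seq (restrict (\<lambda>n. s (n div m) * h n) {1..})"
  have "s (n div m) * h n \<in> {-1, 1}" if "n \<ge> 1" for n
    using s[of "n div m"] h_sign[OF that] by auto
  then have "restrict (\<lambda>n. s (n div m) * h n) {1..} \<in> {1..} \<rightarrow>\<^sub>E {-1, 1}"
    unfolding restrict_PiE_iff by simp
  then have sgn_x: "sgn_at x n = s (n div m) * h n" if "n \<ge> 1" for n
    using that by (simp add: x_def Abs_sign_seq_inverse)
  have "(\<Sum>n = 1..N. sgn_at x n *\<^sub>R a n) = (\<Sum>n<Suc N. (s (n div m) * g n) *\<^sub>R a n)" for N
    by (rule sum.mono_neutral_cong_left) (auto simp: sgn_x g_def)
  then have "convergent (\<lambda>N. \<Sum>n = 1..N. sgn_at x n *\<^sub>R a n)"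
    using conv convergent_Suc_iff[of "\<lambda>N. \<Sum>n<N. (s (n div m) * g n) *\<^sub>R a n"] by presburger
  moreover have "equal_up_to_block_signs m h x"
    unfolding equal_up_to_block_signs_def using s sgn_x by blast
  ultimately show ?thesis by (rule that)
qed

theorem theorem1p3:
  fixes a :: "nat \<Rightarrow> real ^ 'd::finite"
  assumes "CARD('d) \<ge> 2"
    and "(\<lambda>n. norm (a n)) \<longlonglongrightarrow> 0"
  shows "hausdorff_dim {\<epsilon> :: sign_seq. convergent (\<lambda>N. \<Sum>n = 1..N. sgn_at \<epsilon> n *\<^sub>R a n)} = 1"
    (is "hausdorff_dim ?E = 1")
proof (rule antisym)
  show "hausdorff_dim ?E \<le> 1"
    by (rule hausdorff_dim_sign_seq_le_1)
  have a: "a \<longlonglongrightarrow> 0"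
    using assms(2) by (rule tendsto_norm_zero_cancel)
  have "1 \<le> t" if t: "0 \<le> t" "hausdorff_measure t ?E = 0" for t
  proof (rule ccontr)
    assume "\<not> 1 \<le> t"
    then have "t < 1" by simp
    \<comment> \<open>The block length \<open>m\<close> must be large enough that
      \<open>t \<le> 1 - 1/m\<close>.\<close>
    obtain k where "inverse (real (Suc k)) < 1 - t"
      using reals_Archimedean[of "1 - t"] \<open>t < 1\<close> by auto
    then obtain m where m: "m > 0" "1 / real m \<le> 1 - t"
      by (intro that[of "Suc k"]) (auto simp: inverse_eq_divide)
    have "hausdorff_measure t ?E \<noteq> 0"
      using t(1) \<open>t < 1\<close> m
    proof (rule hausdorff_measure_nonzero)
      fix h :: "nat \<Rightarrow> real" assume "h \<in> {1..} \<rightarrow>\<^sub>E {-1, 1}"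
      then show "\<exists>x\<in>?E. equal_up_to_block_signs m h x"
        using exists_convergent_equal_up_to_block_signs[OF a m(1)] by blast
    qed
    with t(2) show False by simp
  qed
  then show "1 \<le> hausdorff_dim ?E"
    unfolding hausdorff_dim_def by (auto intro!: INF_greatest)
qed

end
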